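(* The following equations are derivable in equational logic from $\mathrm{EqMSCL}$: (M3) $((x\land_s y)\lor_s(\neg x\land_s z))\land_s u=(x\land_s(y\land_s u))\lor_s(\neg x\land_s(z\land_s u))$, (LD) $x\land_s(y\lor_s z)=(x\land_s y)\lor_s(x\land_s z)$.
   Context: $A$ is a non-empty set of atoms; terms are over the signature $\Sigma_{SCL}(A)=\{\land_s,\lor_s,\neg,\mathsf T,\mathsf F\}\cup A$ with variables. $\mathrm{EqMSCL}$ is the set of axioms (Neg) $\mathsf F=\neg\mathsf T$, (Or) $x\lor_s y=\neg(\neg x\land_s\neg y)$, (Tand) $\mathsf T\land_s x=x$, (Abs) $x\land_s(x\lor_s y)=x$, (Mem) $(x\lor_s y)\land_s z=(\neg x\land_s(y\land_s z))\lor_s(x\land_s z)$. *)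

theory Defs
  imports Main
begin

text \<open>
  Terms over the signature \<open>\<Sigma>_SCL(A)\<close> with variables. The non-empty set \<open>A\<close> of atoms is the
  universe of the type \<open>'a\<close>; atoms are constants, untouched by substitution. Strings serve as the
  countably infinite set of variables.
\<close>

type_synonym var = string

datatype 'a scl_term =
    Var var
  | Atom 'a
  | Tr  ("\<T>")
  | Fa  ("\<F>")
  | Neg "'a scl_term"  ("\<sim> _" [80] 80)
  | And "'a scl_term" "'a scl_term"  (infixr "\<and>\<^sub>s" 70)
  | Or "'a scl_term" "'a scl_term"  (infixr "\<or>\<^sub>s" 65)

primrec subst :: "(var \<Rightarrow> 'a scl_term) \<Rightarrow> 'a scl_term \<Rightarrow> 'a scl_term" where
  "subst \<sigma> (Var v) = \<sigma> v"
| "subst \<sigma> (Atom a) = Atom a"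
| "subst \<sigma> \<T> = \<T>"
| "subst \<sigma> \<F> = \<F>"
| "subst \<sigma> (\<sim> t) = \<sim> subst \<sigma> t"
| "subst \<sigma> (s \<and>\<^sub>s t) = subst \<sigma> s \<and>\<^sub>s subst \<sigma> t"
| "subst \<sigma> (s \<or>\<^sub>s t) = subst \<sigma> s \<or>\<^sub>s subst \<sigma> t"

datatype 'a equation = Eq "'a scl_term" "'a scl_term"  (infix "\<approx>" 50)

inductive derivable :: "'a equation set \<Rightarrow> 'a equation \<Rightarrow> bool"  (infix "\<turnstile>" 45)
  for E :: "'a equation set" where
  ax: "e \<in> E \<Longrightarrow> E \<turnstile> e"
| refl: "E \<turnstile> t \<approx> t"
| sym: "E \<turnstile> s \<approx> t \<Longrightarrow> E \<turnstile> t \<approx> s"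
| trans: "E \<turnstile> s \<approx> t \<Longrightarrow> E \<turnstile> t \<approx> u \<Longrightarrow> E \<turnstile> s \<approx> u"
| inst: "E \<turnstile> s \<approx> t \<Longrightarrow> E \<turnstile> subst \<sigma> s \<approx> subst \<sigma> t"
| cong_Neg: "E \<turnstile> s \<approx> t \<Longrightarrow> E \<turnstile> \<sim> s \<approx> \<sim> t"
| cong_And: "E \<turnstile> s \<approx> s' \<Longrightarrow> E \<turnstile> t \<approx> t' \<Longrightarrow> E \<turnstile> s \<and>\<^sub>s t \<approx> s' \<and>\<^sub>s t'"
| cong_Or: "E \<turnstile> s \<approx> s' \<Longrightarrow> E \<turnstile> t \<approx> t' \<Longrightarrow> E \<turnstile> s \<or>\<^sub>s t \<approx> s' \<or>\<^sub>s t'"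

abbreviation var_x :: "'a scl_term"  ("\<^bold>x") where "\<^bold>x \<equiv> Var ''x''"
abbreviation var_y :: "'a scl_term"  ("\<^bold>y") where "\<^bold>y \<equiv> Var ''y''"
abbreviation var_z :: "'a scl_term"  ("\<^bold>z") where "\<^bold>z \<equiv> Var ''z''"
abbreviation var_u :: "'a scl_term"  ("\<^bold>u") where "\<^bold>u \<equiv> Var ''u''"

definition Neg_ax :: "'a equation" where
  "Neg_ax = (\<F> \<approx> \<sim> \<T>)"

definition Or_ax :: "'a equation" where
  "Or_ax = (\<^bold>x \<or>\<^sub>s \<^bold>y \<approx> \<sim> (\<sim> \<^bold>x \<and>\<^sub>s \<sim> \<^bold>y))"

definition Tand_ax :: "'a equation" where
  "Tand_ax = (\<T> \<and>\<^sub>s \<^bold>x \<approx> \<^bold>x)"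

definition Abs_ax :: "'a equation" where
  "Abs_ax = (\<^bold>x \<and>\<^sub>s (\<^bold>x \<or>\<^sub>s \<^bold>y) \<approx> \<^bold>x)"

definition Mem_ax :: "'a equation" where
  "Mem_ax = ((\<^bold>x \<or>\<^sub>s \<^bold>y) \<and>\<^sub>s \<^bold>z \<approx> (\<sim> \<^bold>x \<and>\<^sub>s (\<^bold>y \<and>\<^sub>s \<^bold>z)) \<or>\<^sub>s (\<^bold>x \<and>\<^sub>s \<^bold>z))"

definition EqMSCL :: "'a equation set" where
  "EqMSCL = {Neg_ax, Or_ax, Tand_ax, Abs_ax, Mem_ax}"

end

(*
  Provable equality is a congruence on terms whose quotient is an algebra satisfying the axioms, so
  both equations may be proved in an arbitrary such algebra. There the axioms are closed under
  exchanging conjunction with disjunction and truth with falsity. The crux is associativity of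
  conjunction: the restricted law (x y)(x z) = x (y (x z)) shows that after x the value of x is
  remembered, so that a later test "not x or y" may be replaced by y even inside a conjunction.
  The dual of (LD) then follows from (Mem) because, after "not x", the test "x or z" may be replaced by z.
  For (M3) one first shows that the two disjuncts on the right of (Mem) commute.
*)

theory Submission
  imports Defs
begin

section \<open>Double negation and duality\<close>

locale mscl =
  fixes neg :: "'b \<Rightarrow> 'b" and con dis :: "'b \<Rightarrow> 'b \<Rightarrow> 'b" and T F :: 'b
  assumes F_def: "F = neg T"
    and dis_def: "dis x y = neg (con (neg x) (neg y))"
    and T_con: "con T x = x"
    and con_absorb: "con x (dis x y) = x"
    and mem: "con (dis x y) z = dis (con (neg x) (con y z)) (con x z)"
begin

lemma T_dis: "dis T x = T"
  using con_absorb[of T x] by (simp add: T_con)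

text \<open>\<open>mem\<close> at \<open>T\<close> exhibits every element as a negation, so
  \<open>neg (con F (neg y)) = T\<close> extends to \<open>neg (con F z) = T\<close> for all
  \<open>z\<close>. Fed back into the same identity, this leaves
  \<open>neg (neg x) = x\<close>.\<close>

lemma neg_neg [simp]: "neg (neg x) = x"
proof -
  have *: "neg (con (neg (con F (con y z))) (neg z)) = z" for y z
    using mem[of T y z] dis_def[of "con F (con y z)" z] by (simp only: T_dis T_con F_def[symmetric])
  have "neg (con F (neg y)) = T" for y
    using T_dis[of y] by (simp add: dis_def F_def)
  then have "neg (con F z) = T" for z
    using *[of T z] by metis
  then show ?thesis
    using *[of T x] by (simp add: T_con)
qed

lemma neg_T [simp]: "neg T = F" and neg_F [simp]: "neg F = T"
  by (simp_all add: F_def)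

lemma neg_con: "neg (con x y) = dis (neg x) (neg y)"
  and neg_dis: "neg (dis x y) = con (neg x) (neg y)"
  by (simp_all add: dis_def)

lemma F_con: "con F x = F"
  using arg_cong[OF T_dis[of "neg x"], of neg] by (simp add: neg_dis)

text \<open>Negating an axiom at negated arguments yields its dual. Each law \<open>l\<close> of the
  locale is thus also available in dual form as \<open>mscl.l[OF dual]\<close>.\<close>

lemma dual: "mscl neg dis con F T"
proof
  show "T = neg F"
    by simp
  show "con x y = neg (dis (neg x) (neg y))" for x y
    by (simp add: neg_dis)
  show "dis F x = x" for x
    by (simp add: dis_def T_con)
  show "dis x (con x y) = x" for x y
    using arg_cong[OF con_absorb[of "neg x" "neg y"], of neg] by (simp add: neg_con neg_dis)
  show "dis (con x y) z = con (dis (neg x) (dis y z)) (dis x z)" for x y z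
    using arg_cong[OF mem[of "neg x" "neg y" "neg z"], of neg] by (simp add: neg_con neg_dis)
qed

lemmas F_dis = mscl.T_con[OF dual]
lemmas dis_absorb = mscl.con_absorb[OF dual]

section \<open>The constants and idempotence\<close>

lemma dis_F: "dis x F = x"
proof -
  have "dis (con x y) F = con x y" for x y
    using mem[of F x y] by (simp add: F_con F_dis T_con)
  \<comment> \<open>By absorption every element is a conjunction.\<close>
  then show ?thesis
    using con_absorb[of x x] by metis
qed

lemmas con_T = mscl.dis_F[OF dual]

lemma con_idem: "con x x = x"
  using con_absorb[of x F] by (simp add: dis_F)

lemma dis_rotate: "dis (con (neg x) y) x = dis x y"
  using mem[of x y T] by (simp add: con_T)

lemmas con_rotate = mscl.dis_rotate[OF dual]

lemma neg_con_self: "con (neg x) x = con x F"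
  using con_rotate[of x F] by (simp add: dis_F)

lemma con_neg: "con x (neg x) = con x F"
  using con_rotate[of x "neg x"] by (simp add: mscl.con_idem[OF dual] neg_con_self)

lemma neg_con_F: "con (neg x) F = con x F"
  using con_neg[of "neg x"] by (simp add: neg_con_self)

lemma neg_con_con: "con (neg x) (con x y) = con x F"
  using con_rotate[of "neg x" "con x y"] by (simp add: dis_absorb con_neg)

lemma dis_con_F_con: "dis (con x F) (con x y) = con x y"
  using mem[of x F y] by (simp add: dis_F F_con neg_con_F)

lemma dis_T_con: "con (dis x T) y = dis (con (neg x) y) (con x y)"
  using mem[of x T y] by (simp add: T_con)

text \<open>For \<open>w = con x F\<close> the negation is \<open>dis x T\<close>, whence
  \<open>con w F = con (neg w) F = dis w w = w\<close>. Then \<open>dis w (con w y)\<close> equals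
  \<open>con w y\<close> by \<open>dis_con_F_con\<close> and \<open>w\<close> by absorption.\<close>

lemma con_F_con: "con (con x F) y = con x F"
proof -
  have "con (con x F) F = dis (con x F) (con x F)"
    using dis_T_con[of "con x F" F] dis_T_con[of x F] neg_con_F[of "con x F"]
    by (simp add: neg_con neg_con_F mscl.neg_con_F[OF dual])
  then have "con (con x F) F = con x F"
    by (simp only: mscl.con_idem[OF dual])
  then show ?thesis
    using dis_con_F_con[of "con x F" y] dis_absorb[of "con x F" y] by simp
qed

text \<open>Two ways to evaluate \<open>x\<close>, ignore its value and continue with
  \<open>y\<close>.\<close>

lemma dis_T_con_eq: "con (dis x T) y = dis (con x F) y"
proof -
  have "dis (con x F) T = con (dis (neg x) T) (dis x T)"
    using mscl.mem[OF dual, of x F T] by (simp add: F_dis)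
  then have T: "dis (con x F) T = dis x T"
    by (simp add: mscl.neg_con_F[OF dual] con_idem)
  have "con (dis (con x F) T) y = dis (con (neg (con x F)) y) (con x F)"
    by (simp add: dis_T_con con_F_con)
  then show ?thesis
    by (simp only: T dis_rotate)
qed

section \<open>Memory: repeated evaluation\<close>

lemma con_con_left: "con x (con x y) = con x y"
proof -
  have "con (dis x T) (con x y) = dis (con x F) (con x (con x y))"
    by (simp add: dis_T_con neg_con_con)
  then show ?thesis
    by (simp add: dis_con_F_con dis_T_con_eq)
qed

lemma dis_con_con_F: "dis (con x y) (con x F) = con x y"
proof -
  have "con (dis (neg x) T) (con x y) = dis (con x y) (con x F)"
    using dis_T_con[of "neg x" "con x y"] by (simp add: neg_con_con con_con_left)
  then show ?thesis
    by (simp add: mscl.neg_con_F[OF dual] dis_T_con_eq dis_con_F_con)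
qed

text \<open>Both sides equal \<open>con (dis (neg x) y) x\<close>, by \<open>mem\<close> and by
  \<open>con_rotate\<close>; the second disjunct from \<open>mem\<close> is \<open>con x F\<close>,
  which \<open>dis_con_con_F\<close> removes.\<close>

lemma con_memory: "con x (con y x) = con x y"
  using mem[of "neg x" y x] by (simp add: con_rotate neg_con_self dis_con_con_F)

lemma con_dis_neg: "con x (dis (neg x) y) = con x y"
  using con_memory[of x "dis (neg x) y"] by (simp add: con_rotate con_con_left)

lemma neg_con_dis: "con (neg x) (dis x y) = con (neg x) y"
  using con_dis_neg[of "neg x"] by simp

lemma con_right_absorb: "con (con x y) x = con x y"
  using con_memory[of "con x y" x] by (simp add: con_con_left con_idem)

lemma dis_right_con: "con (dis x y) y = con (dis x T) y"
  by (simp add: mem T_con con_idem)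

lemma con_right_dis: "dis (con x y) y = con (dis x T) y"
  using mscl.dis_right_con[OF dual] by (simp add: dis_T_con_eq)

lemma dis_con_F_mem: "con (dis (con x F) y) z = dis (con x F) (con y z)"
  by (simp add: mem con_F_con dis_rotate)

text \<open>With \<open>w = con x y\<close>, evaluate \<open>con (dis w x) y\<close> twice:
  rewriting \<open>dis w x\<close> as \<open>dis (con w F) x\<close> gives \<open>w\<close>, while
  \<open>mem\<close> gives \<open>con w y\<close>.\<close>

lemma con_con_right: "con (con x y) y = con x y"
proof -
  let ?w = "con x y"
  have "dis ?w x = dis (con ?w F) x"
    using con_right_dis[of ?w x] by (simp add: con_right_absorb dis_T_con_eq)
  then have "con (dis ?w x) y = dis (con ?w F) ?w"
    by (simp add: dis_con_F_mem)
  also have "\<dots> = ?w"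
    using dis_con_F_con[of ?w T] by (simp add: con_T)
  finally have "con (dis ?w x) y = ?w" .
  moreover have "con (dis ?w x) y = dis (con ?w F) (con ?w y)"
    by (simp add: mem neg_con_self)
  ultimately show ?thesis
    by (simp add: dis_con_F_con)
qed

section \<open>Associativity of conjunction\<close>

lemma dis_con_con: "con (dis x y) (con y z) = con (dis x T) (con y z)"
  by (simp add: mem[of x y] dis_T_con con_con_left)

text \<open>Since \<open>dis x (con x y) = x\<close>, \<open>dis_con_con\<close> turns the leading
  \<open>x\<close> into \<open>dis x T\<close>, which is absorbed into
  \<open>con x y\<close>.\<close>

lemma con_assoc_left: "con x (con (con x y) z) = con (con x y) z"
proof -
  let ?w = "con x y"
  have "con x (con ?w z) = con (dis x T) (con ?w z)"
    using dis_con_con[of x ?w z] by (simp add: dis_absorb)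
  also have "\<dots> = con (dis (con x F) ?w) z"
    by (simp add: dis_T_con_eq dis_con_F_mem)
  finally show ?thesis
    by (simp add: dis_con_F_con)
qed

lemma dis_con_right: "con (dis x (con y z)) z = con (dis x y) z"
  by (simp add: mem con_con_right)

lemma con_neg_con_left: "con x (neg (con x y)) = con x (neg y)"
  using con_dis_neg[of x "neg y"] by (simp add: neg_con)

lemma con_neg_con_right: "con x (neg (con y x)) = con x (neg y)"
  using con_neg_con_left[of x "con y x"] by (simp add: con_memory con_neg_con_left)

text \<open>By \<open>dis_con_right\<close>, \<open>dis (neg y) z\<close> and
  \<open>dis (neg y) (con z x)\<close> agree when followed by \<open>x\<close>;
  \<open>con_neg_con_right\<close> transfers this to their negations after \<open>x\<close>.\<close>

lemma con_con_neg_con: "con x (con y (neg (con z x))) = con x (con y (neg z))"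
  using con_neg_con_right[of x "dis (neg y) z"] con_neg_con_right[of x "dis (neg y) (con z x)"]
  by (simp add: dis_con_right neg_dis)

text \<open>The right side equals \<open>con (dis (neg x) y) (con x z)\<close>, which does not
  change when \<open>y\<close> becomes \<open>con x y\<close>; \<open>con_assoc_left\<close> then
  drops the extra leading \<open>x\<close>.\<close>

lemma con_con_con: "con (con x y) (con x z) = con x (con y (con x z))"
proof -
  have *: "con (dis (neg x) y) (con x z) = con x (con y (con x z))" for y
    by (simp add: mem neg_con_con dis_con_con_F)
  have "dis (neg x) (con x y) = dis (neg x) y"
    using mscl.con_dis_neg[OF dual, of "neg x"] by simp
  then have "con x (con (con x y) (con x z)) = con x (con y (con x z))"
    by (simp only: *[symmetric])
  then show ?thesis
    by (simp only: con_assoc_left)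
qed

lemma con_dis_con_self: "con x (con (dis x y) (con x z)) = con x z"
  using con_con_con[of x "dis x y" z] by (simp add: con_absorb con_con_left)

lemma con_neg_con_dis: "con x (neg (con y (dis x z))) = con x (neg y)"
proof -
  \<comment> \<open>A copy of \<open>dis x z\<close> is inserted in front, so that
    \<open>con_con_neg_con\<close> can remove the inner one.\<close>
  have "con x (neg (con y (dis x z))) =
      con x (con (dis x z) (con x (neg (con y (dis x z)))))"
    by (rule con_dis_con_self[symmetric])
  also have "\<dots> = con x (neg y)"
    by (simp only: con_con_neg_con con_dis_con_self)
  finally show ?thesis .
qed

text \<open>Rewriting the right side of \<open>mem\<close> as a negated conjunction exposes a factor
  \<open>dis x (neg z)\<close>, which \<open>con_neg_con_dis\<close> discards after
  \<open>x\<close>.\<close>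

lemma con_dis_neg_con: "con x (con (dis (neg x) y) z) = con x (con y z)"
proof -
  have "con (dis (neg x) y) z = neg (con (neg (con x (con y z))) (dis x (neg z)))"
    using mem[of "neg x" y z] by (simp only: neg_neg neg_con neg_dis)
  then have "con x (con (dis (neg x) y) z) = con x (con x (con y z))"
    by (simp only: con_neg_con_dis neg_neg)
  then show ?thesis
    by (simp only: con_con_left)
qed

text \<open>Both sides reduce to \<open>con x (con (dis (neg x) y) z)\<close>, because
  \<open>dis (neg x) (con x y) = dis (neg x) y\<close>.\<close>

lemma con_assoc: "con (con x y) z = con x (con y z)"
proof -
  have "con x (con (con x y) z) = con x (con (dis (neg x) (con x y)) z)"
    by (simp only: con_dis_neg_con)
  also have "dis (neg x) (con x y) = dis (neg x) y"
    using mscl.con_dis_neg[OF dual, of "neg x"] by simp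
  finally show ?thesis
    by (simp add: con_dis_neg_con con_assoc_left)
qed

section \<open>Distributivity and the order of disjuncts\<close>

lemma con_dis_con: "con x (con (dis x y) z) = con x z"
  by (simp add: con_assoc[symmetric] con_absorb)

lemma con_con_con_left: "con x (con y (con x z)) = con x (con y z)"
  by (simp add: con_assoc[symmetric] con_right_absorb)

lemma con_con_dis: "con x (con y (dis x z)) = con x y"
  using con_con_con_left[of x y "dis x z"] by (simp add: con_absorb con_memory)

lemma con_dis_distrib: "con x (dis y z) = dis (con x y) (con x z)"
proof -
  \<comment> \<open>A second \<open>neg x\<close> can be inserted after \<open>y\<close>, and there
    \<open>neg_con_dis\<close> applies.\<close>
  have "con (neg x) (con y (dis x z)) = con (neg x) (con y z)" for x y z
    using con_con_con_left[of "neg x" y "dis x z"] con_con_con_left[of "neg x" y z]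
    by (simp add: neg_con_dis)
  then have "con (dis x y) (dis x z) = dis x (con y z)" for x y z
    by (simp add: mem con_absorb dis_rotate)
  then have "neg (dis (neg x) (con (neg y) (neg z))) = neg (con (dis (neg x) (neg y)) (dis (neg x) (neg z)))"
    by simp
  then show ?thesis
    by (simp add: neg_con neg_dis)
qed

text \<open>A tool for \<open>mem_swap\<close>: if \<open>dis x y\<close> acts as a left identity on
  \<open>dis y x\<close>, then \<open>dis x y = dis x (dis y x)\<close>.\<close>

lemma dis_con_dis: "dis x (con (dis x y) (dis y x)) = dis x y"
proof -
  have "con (dis x (dis y x)) (dis y x) = dis (con x F) (dis y x)"
    by (simp add: dis_right_con dis_T_con_eq)
  then show ?thesis
    using mscl.con_dis_con[OF dual, of x F] mscl.con_memory[OF dual, of x y] by simp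
qed

lemma con_dis_con_left: "con (dis x T) (con (dis x y) z) = con (dis x y) z"
  using mscl.con_dis_distrib[OF dual, of x T y] by (simp add: con_assoc[symmetric] T_con)

text \<open>Here \<open>dis ?v ?u = ?w\<close> is \<open>mem\<close>. Showing
  \<open>con (dis ?u ?v) ?w = ?w\<close> lets \<open>dis_con_dis\<close> give
  \<open>dis ?u ?v = dis ?u ?w\<close>, and \<open>?u = con x ?w\<close> makes the latter
  \<open>?w\<close>.\<close>

lemma mem_swap: "con (dis x y) z = dis (con x z) (con (neg x) (con y z))"
proof -
  let ?u = "con x z" and ?v = "con (neg x) (con y z)" and ?w = "con (dis x y) z"
  have x_w: "con x ?w = con x z"
    by (rule con_dis_con)
  have neg_x_w: "dis (neg x) ?w = dis (neg x) z"
    using mscl.neg_con_dis[OF dual, of x ?w] mscl.neg_con_dis[OF dual, of x z] by (simp add: x_w)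
  \<comment> \<open>Factored as a conjunction, so that each factor can be shown separately to leave
    \<open>?w\<close> unchanged.\<close>
  have "dis ?u ?v = con (dis (neg x) z) (dis x (con y z))"
    using mem[of "neg x" z "dis x (con y z)"] by (simp add: con_con_dis neg_con_dis)
  moreover have "con (dis x (con y z)) ?w = ?w"
  proof -
    have "con (dis x (con y z)) (dis x y) = dis x (con y z)"
      using mscl.con_dis_distrib[OF dual, of x "con y z" y] by (simp add: con_right_absorb)
    then show ?thesis
      by (simp add: con_assoc[symmetric] dis_con_right)
  qed
  moreover have "con (dis (neg x) z) ?w = ?w"
    using dis_right_con[of "neg x" ?w] by (simp add: neg_x_w mscl.neg_con_F[OF dual] con_dis_con_left)
  ultimately have "con (dis ?u ?v) ?w = ?w"
    by (simp add: con_assoc)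
  moreover have "dis ?v ?u = ?w"
    by (simp add: mem)
  ultimately have "dis ?u ?v = dis ?u ?w"
    using dis_con_dis[of ?u ?v] by simp
  also have "\<dots> = ?w"
    using con_right_dis[of x ?w] by (simp add: x_w con_dis_con_left)
  finally show ?thesis by simp
qed

lemma dis_con_swap: "dis (con x y) (con (neg x) z) = con (dis x z) (dis (neg x) y)"
  using mem_swap[of x z "dis (neg x) y"] by (simp add: con_con_dis con_dis_neg)

lemma con_con_dis_con: "con x (con y (con (dis x z) u)) = con x (con y u)"
  using arg_cong[OF con_con_dis[of x y z], of "\<lambda>w. con w u"] by (simp add: con_assoc)

text \<open>As a conjunction, by \<open>dis_con_swap\<close>, the conditional reassociates with
  \<open>u\<close>. Expanding by \<open>mem_swap\<close> puts \<open>dis (neg x) y\<close> after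
  \<open>x\<close>, where it becomes \<open>y\<close>, and after \<open>neg x\<close>, where it
  disappears.\<close>

lemma dis_con_neg_con: "con (dis (con x y) (con (neg x) z)) u =
    dis (con x (con y u)) (con (neg x) (con z u))"
proof -
  have "con (dis (con x y) (con (neg x) z)) u = con (dis x z) (con (dis (neg x) y) u)"
    by (simp add: dis_con_swap con_assoc)
  also have "\<dots> = dis (con x (con y u)) (con (neg x) (con z u))"
    using con_con_dis_con[of "neg x" z y u] by (simp add: mem_swap[of x z] con_dis_neg_con)
  finally show ?thesis .
qed

end

\<comment> \<open>The algebra of terms modulo provable equality\<close>
quotient_type 'a free_mscl = "'a scl_term" / "\<lambda>s t. EqMSCL \<turnstile> s \<approx> t"
  by (intro equivpI reflpI sympI transpI) (blast intro: derivable.intros)+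

lift_definition free_neg :: "'a free_mscl \<Rightarrow> 'a free_mscl" is Neg
  by (rule derivable.cong_Neg)

lift_definition free_con :: "'a free_mscl \<Rightarrow> 'a free_mscl \<Rightarrow> 'a free_mscl" is And
  by (rule derivable.cong_And)

lift_definition free_dis :: "'a free_mscl \<Rightarrow> 'a free_mscl \<Rightarrow> 'a free_mscl" is Or
  by (rule derivable.cong_Or)

lift_definition free_T :: "'a free_mscl" is Tr .

lift_definition free_F :: "'a free_mscl" is Fa .

lemma EqMSCL_instance:
  assumes "(s \<approx> t) \<in> EqMSCL"
  shows "EqMSCL \<turnstile> subst \<sigma> s \<approx> subst \<sigma> t"
  using assms by (intro derivable.inst derivable.ax)

interpretation free: mscl free_neg free_con free_dis free_T free_F
proof
  show "free_F = free_neg free_T"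
    by transfer (rule derivable.ax, simp add: EqMSCL_def Neg_ax_def)
  show "free_dis x y = free_neg (free_con (free_neg x) (free_neg y))" for x y :: "'a free_mscl"
  proof transfer
    fix x y :: "'a scl_term"
    show "EqMSCL \<turnstile> x \<or>\<^sub>s y \<approx> \<sim> (\<sim> x \<and>\<^sub>s \<sim> y)"
      \<comment> \<open>The default value of the substitution serves the remaining variable of the
        axiom.\<close>
      using EqMSCL_instance[where \<sigma> = "(\<lambda>_. y)(''x'' := x)"
          and s = "\<^bold>x \<or>\<^sub>s \<^bold>y" and t = "\<sim> (\<sim> \<^bold>x \<and>\<^sub>s \<sim> \<^bold>y)"]
      by (simp add: EqMSCL_def Or_ax_def)
  qed
  show "free_con free_T x = x" for x :: "'a free_mscl"
  proof transfer
    fix x :: "'a scl_term"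
    show "EqMSCL \<turnstile> \<T> \<and>\<^sub>s x \<approx> x"
      using EqMSCL_instance[where \<sigma> = "\<lambda>_. x" and s = "\<T> \<and>\<^sub>s \<^bold>x" and t = "\<^bold>x"]
      by (simp add: EqMSCL_def Tand_ax_def)
  qed
  show "free_con x (free_dis x y) = x" for x y :: "'a free_mscl"
  proof transfer
    fix x y :: "'a scl_term"
    show "EqMSCL \<turnstile> x \<and>\<^sub>s (x \<or>\<^sub>s y) \<approx> x"
      using EqMSCL_instance[where \<sigma> = "(\<lambda>_. y)(''x'' := x)"
          and s = "\<^bold>x \<and>\<^sub>s (\<^bold>x \<or>\<^sub>s \<^bold>y)" and t = "\<^bold>x"]
      by (simp add: EqMSCL_def Abs_ax_def)
  qed
  show "free_con (free_dis x y) z = free_dis (free_con (free_neg x) (free_con y z)) (free_con x z)"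
    for x y z :: "'a free_mscl"
  proof transfer
    fix x y z :: "'a scl_term"
    show "EqMSCL \<turnstile> (x \<or>\<^sub>s y) \<and>\<^sub>s z \<approx> (\<sim> x \<and>\<^sub>s (y \<and>\<^sub>s z)) \<or>\<^sub>s (x \<and>\<^sub>s z)"
      using EqMSCL_instance[where \<sigma> = "(\<lambda>_. z)(''x'' := x, ''y'' := y)"
          and s = "(\<^bold>x \<or>\<^sub>s \<^bold>y) \<and>\<^sub>s \<^bold>z" and t = "(\<sim> \<^bold>x \<and>\<^sub>s (\<^bold>y \<and>\<^sub>s \<^bold>z)) \<or>\<^sub>s (\<^bold>x \<and>\<^sub>s \<^bold>z)"]
      by (simp add: EqMSCL_def Mem_ax_def)
  qed
qed

theorem theorem3p6:
  shows "((EqMSCL :: 'a equation set) \<turnstile>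
      ((\<^bold>x \<and>\<^sub>s \<^bold>y) \<or>\<^sub>s (\<sim> \<^bold>x \<and>\<^sub>s \<^bold>z)) \<and>\<^sub>s \<^bold>u
        \<approx> (\<^bold>x \<and>\<^sub>s (\<^bold>y \<and>\<^sub>s \<^bold>u)) \<or>\<^sub>s (\<sim> \<^bold>x \<and>\<^sub>s (\<^bold>z \<and>\<^sub>s \<^bold>u)))
     \<and> ((EqMSCL :: 'a equation set) \<turnstile>
      \<^bold>x \<and>\<^sub>s (\<^bold>y \<or>\<^sub>s \<^bold>z) \<approx> (\<^bold>x \<and>\<^sub>s \<^bold>y) \<or>\<^sub>s (\<^bold>x \<and>\<^sub>s \<^bold>z))"
proof
  \<comment> \<open>At the classes of the variables, an identity of the quotient is exactly
    derivability of the equation.\<close>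
  show "EqMSCL \<turnstile> ((\<^bold>x \<and>\<^sub>s \<^bold>y) \<or>\<^sub>s (\<sim> \<^bold>x \<and>\<^sub>s \<^bold>z)) \<and>\<^sub>s \<^bold>u
      \<approx> (\<^bold>x \<and>\<^sub>s (\<^bold>y \<and>\<^sub>s \<^bold>u)) \<or>\<^sub>s (\<sim> \<^bold>x \<and>\<^sub>s (\<^bold>z \<and>\<^sub>s \<^bold>u))"
    using free.dis_con_neg_con[of "abs_free_mscl \<^bold>x" "abs_free_mscl \<^bold>y" "abs_free_mscl \<^bold>z"
        "abs_free_mscl \<^bold>u"]
    by (simp add: free_neg.abs_eq free_con.abs_eq free_dis.abs_eq free_mscl.abs_eq_iff)
  show "EqMSCL \<turnstile> \<^bold>x \<and>\<^sub>s (\<^bold>y \<or>\<^sub>s \<^bold>z) \<approx> (\<^bold>x \<and>\<^sub>s \<^bold>y) \<or>\<^sub>s (\<^bold>x \<and>\<^sub>s \<^bold>z)"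
    using free.con_dis_distrib[of "abs_free_mscl \<^bold>x" "abs_free_mscl \<^bold>y" "abs_free_mscl \<^bold>z"]
    by (simp add: free_con.abs_eq free_dis.abs_eq free_mscl.abs_eq_iff)
qed

end
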